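(* There is no $3\times 3$ permutative nonnegative matrix with spectrum $\Lambda=\{6,5,1\}$.
   Context: An $n\times n$ matrix is permutative if every one of its rows is a permutation of its first row. Nonnegative is meant entrywise. The spectrum is the list of eigenvalues counted with algebraic multiplicity. *)

theory Defs
  imports "Jordan_Normal_Form.Char_Poly" "HOL-Combinatorics.Permutations" Complex_Main
begin

definition permutative_mat :: "'a mat \<Rightarrow> bool" where
  "permutative_mat A \<longleftrightarrow> square_mat A \<and>
     (\<forall>i<dim_row A. \<exists>\<pi>. \<pi> permutes {..<dim_col A} \<and>
        (\<forall>j<dim_col A. A $$ (i, j) = A $$ (0, \<pi> j)))"

definition nonneg_mat :: "real mat \<Rightarrow> bool" where
  "nonneg_mat A \<longleftrightarrow> (\<forall>i<dim_row A. \<forall>j<dim_col A. 0 \<le> A $$ (i, j))"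

text \<open>The spectrum as a list with algebraic multiplicities: the multiset of all complex
  roots of the characteristic polynomial. (The library's \<open>spectrum\<close> is only the set of
  eigenvalues.)\<close>

definition spectrum_mset :: "real mat \<Rightarrow> complex multiset" where
  "spectrum_mset A = proots (char_poly (map_mat complex_of_real A))"

end

theory Submission
  imports Defs
begin

text \<open>The row sum \<open>s\<close> is an eigenvalue, so \<open>s \<in> {1, 5, 6}\<close>, while trace and second elementary symmetric
  function are \<open>12\<close> and \<open>41\<close>. The diagonal entries come from the first row \<open>(x, y, z)\<close>.
  If all are equal, each is \<open>4\<close>, so the other two entries of every row sum to at most \<open>2\<close> and
  the principal 2-minors sum to at least \<open>48 - 4\<close>. If the diagonal is \<open>x, x, y\<close>, then
  \<open>2 x + y = 12\<close> forces \<open>x = 6\<close>, \<open>y = z = 0\<close>, and those minors sum to at most \<open>36\<close>. If it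
  is \<open>x, y, z\<close>, the trace is \<open>s \<le> 6\<close>.\<close>

lemma det_dim_2:
  assumes "(A :: 'a :: comm_ring_1 mat) \<in> carrier_mat 2 2"
  shows "det A = A $$ (0,0) * A $$ (1,1) - A $$ (0,1) * A $$ (1,0)"
proof -
  have "mat_delete A 0 j \<in> carrier_mat 1 1" for j
    using assms mat_delete_carrier[of A "Suc 1" "Suc 1" 0 j] by (simp add: numeral_2_eq_2)
  then show ?thesis
    using assms by (subst laplace_expansion_row[OF assms, of 0])
      (auto simp: cofactor_def numeral_2_eq_2 det_single mat_delete_def)
qed

lemma det_dim_3:
  assumes "(A :: 'a :: comm_ring_1 mat) \<in> carrier_mat 3 3"
  shows "det A =
    A $$ (0,0) * (A $$ (1,1) * A $$ (2,2) - A $$ (1,2) * A $$ (2,1)) -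
    A $$ (0,1) * (A $$ (1,0) * A $$ (2,2) - A $$ (1,2) * A $$ (2,0)) +
    A $$ (0,2) * (A $$ (1,0) * A $$ (2,1) - A $$ (1,1) * A $$ (2,0))"
proof -
  have "mat_delete A 0 j \<in> carrier_mat 2 2" for j
    using assms mat_delete_carrier[of A "Suc 2" "Suc 2" 0 j] by (simp add: numeral_3_eq_3 numeral_2_eq_2)
  moreover have "mat_delete A 0 j $$ (k, l) = A $$ (Suc k, if l < j then l else Suc l)"
    if "k < 2" "l < 2" for j k l
    using assms that by (simp add: mat_delete_def)
  ultimately have minor: "det (mat_delete A 0 j) =
      A $$ (1, if 0 < j then 0 else 1) * A $$ (2, if 1 < j then 1 else 2) -
      A $$ (1, if 1 < j then 1 else 2) * A $$ (2, if 0 < j then 0 else 1)" for j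
    by (simp add: det_dim_2 numeral_2_eq_2)
  have "{..<3} = {0, 1, 2::nat}" by auto
  then show ?thesis
    by (simp add: laplace_expansion_row[OF assms, of 0] cofactor_def minor algebra_simps)
qed

text \<open>Expansion of \<open>det (x I - A)\<close>: the coefficients are the trace, the sum of
  the principal 2-minors and \<open>det A\<close>, with signs.\<close>

lemma poly_char_poly_dim_3:
  assumes "(A :: 'a :: comm_ring_1 mat) \<in> carrier_mat 3 3"
  shows "poly (char_poly A) x =
    x ^ 3 - (A $$ (0,0) + A $$ (1,1) + A $$ (2,2)) * x ^ 2 +
    (A $$ (0,0) * A $$ (1,1) - A $$ (0,1) * A $$ (1,0) +
     (A $$ (0,0) * A $$ (2,2) - A $$ (0,2) * A $$ (2,0)) +
     (A $$ (1,1) * A $$ (2,2) - A $$ (1,2) * A $$ (2,1))) * x - det A"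
proof -
  have "char_poly_matrix A $$ (i, j) = (if i = j then [:- A $$ (i, j), 1:] else [:- A $$ (i, j):])"
    if "i < 3" "j < 3" for i j
    using assms that by (auto simp: char_poly_matrix_def)
  then show ?thesis
    unfolding char_poly_def det_dim_3[OF assms]
      det_dim_3[OF char_poly_matrix_closed[OF assms]]
    by (simp add: algebra_simps power2_eq_square power3_eq_cube)
qed

text \<open>Moves the complex spectrum back to the reals: forming the characteristic polynomial
  commutes with the embedding, and a monic polynomial is nonzero, so \<open>proots\<close> contains
  exactly its roots.\<close>

lemma poly_char_poly_eq_0_iff_mem_spectrum:
  assumes "A \<in> carrier_mat n n"
  shows "poly (char_poly A) x = 0 \<longleftrightarrow> complex_of_real x \<in># spectrum_mset A"
proof -
  have "char_poly (map_mat complex_of_real A) = map_poly complex_of_real (char_poly A)"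
    by (rule of_real_hom.char_poly_hom[OF assms])
  moreover have "char_poly A \<noteq> 0"
    using degree_monic_char_poly[OF assms] by auto
  ultimately show ?thesis
    by (simp add: spectrum_mset_def)
qed

lemma permutes_lessThan_3_cases:
  assumes "\<pi> permutes {..<3::nat}"
  shows "(\<pi> 0, \<pi> 1, \<pi> 2) \<in> {(0,1,2), (0,2,1), (1,0,2), (1,2,0), (2,0,1), (2,1,0)}"
proof -
  have "\<pi> 0 < 3" "\<pi> 1 < 3" "\<pi> 2 < 3"
    using permutes_in_image[OF assms, of 0] permutes_in_image[OF assms, of 1]
      permutes_in_image[OF assms, of 2] by simp_all
  then have "\<pi> 0 = 0 \<or> \<pi> 0 = 1 \<or> \<pi> 0 = 2" "\<pi> 1 = 0 \<or> \<pi> 1 = 1 \<or> \<pi> 1 = 2"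
    "\<pi> 2 = 0 \<or> \<pi> 2 = 1 \<or> \<pi> 2 = 2"
    by linarith+
  moreover have "\<pi> 0 \<noteq> \<pi> 1" "\<pi> 0 \<noteq> \<pi> 2" "\<pi> 1 \<noteq> \<pi> 2"
    using inj_eq[OF permutes_inj[OF assms]] by simp_all
  ultimately show ?thesis
    by (elim disjE) simp_all
qed

text \<open>Replaces the unknown permutation by six explicit rows, ready for case analysis.\<close>

lemma permutative_mat_dim_3_row_cases:
  assumes "permutative_mat A" "A \<in> carrier_mat 3 3" "i < 3"
  shows "(A $$ (i,0), A $$ (i,1), A $$ (i,2)) \<in>
    (let a = A $$ (0,0); b = A $$ (0,1); c = A $$ (0,2) in
     {(a,b,c), (a,c,b), (b,a,c), (b,c,a), (c,a,b), (c,b,a)})"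
proof -
  have "dim_row A = 3" "dim_col A = 3" using assms(2) by auto
  then obtain \<pi> where "\<pi> permutes {..<3}" and "\<forall>j<3. A $$ (i, j) = A $$ (0, \<pi> j)"
    using assms(1,3) unfolding permutative_mat_def by metis
  then have "A $$ (i, 0) = A $$ (0, \<pi> 0)" "A $$ (i, 1) = A $$ (0, \<pi> 1)"
    "A $$ (i, 2) = A $$ (0, \<pi> 2)"
    by simp_all
  then show ?thesis
    using permutes_lessThan_3_cases[OF \<open>\<pi> permutes {..<3}\<close>]
    by (simp only: Let_def insert_iff empty_iff prod.inject) (elim disjE conjE; simp)
qed

theorem lemma2p2:
  shows "\<not> (\<exists>A \<in> carrier_mat 3 3. permutative_mat A \<and> nonneg_mat A \<and>
           spectrum_mset A = {#6, 5, 1#})"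
proof safe
  fix A :: "real mat"
  assume A: "A \<in> carrier_mat 3 3" and perm: "permutative_mat A" and "nonneg_mat A"
    and spec: "spectrum_mset A = {#6, 5, 1#}"
  define a b c where abc: "a = A $$ (0,0)" "b = A $$ (0,1)" "c = A $$ (0,2)"
  define p q r where pqr: "p = A $$ (1,0)" "q = A $$ (1,1)" "r = A $$ (1,2)"
  define u v w where uvw: "u = A $$ (2,0)" "v = A $$ (2,1)" "w = A $$ (2,2)"
  define s where "s = a + b + c"
  have nonneg: "0 \<le> a" "0 \<le> b" "0 \<le> c"
    using \<open>nonneg_mat A\<close> A by (auto simp: nonneg_mat_def abc)
  have rows:
    "(p, q, r) \<in> {(a,b,c), (a,c,b), (b,a,c), (b,c,a), (c,a,b), (c,b,a)}"
    "(u, v, w) \<in> {(a,b,c), (a,c,b), (b,a,c), (b,c,a), (c,a,b), (c,b,a)}"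
    using permutative_mat_dim_3_row_cases[OF perm A, of 1]
      permutative_mat_dim_3_row_cases[OF perm A, of 2]
    by (simp_all only: abc pqr uvw Let_def)
  define e where "e = (a * q - b * p) + (a * w - c * u) + (q * w - r * v)"
  have char: "poly (char_poly A) x = x ^ 3 - (a + q + w) * x ^ 2 + e * x - det A" for x
    unfolding poly_char_poly_dim_3[OF A] e_def abc pqr uvw by simp
  have root: "poly (char_poly A) x = 0 \<longleftrightarrow> x \<in> {6, 5, 1}" for x
  proof -
    have "complex_of_real x = 6 \<longleftrightarrow> x = 6" "complex_of_real x = 5 \<longleftrightarrow> x = 5"
      using of_real_eq_iff[of x 6] of_real_eq_iff[of x 5] by simp_all
    then show ?thesis
      by (simp add: poly_char_poly_eq_0_iff_mem_spectrum[OF A] spec)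
  qed
  \<comment> \<open>Vanishing at three points gives three linear equations in
    \<open>a + q + w\<close>, \<open>e\<close> and \<open>det A\<close>.\<close>
  have tr: "a + q + w = 12" and e: "e = 41"
    using root[of 6] root[of 5] root[of 1] unfolding char by (simp_all add: power2_eq_square power3_eq_cube)
  have s: "s \<in> {6, 5, 1}"
  proof -
    \<comment> \<open>Every row sums to \<open>s\<close>. Eliminating the first column this way
      turns the vanishing at \<open>s\<close> into a ring identity.\<close>
    have sums: "p = s - q - r" "u = s - v - w" "a = s - b - c"
      using rows by (auto simp: s_def)
    have "poly (char_poly A) s = 0"
      unfolding char det_dim_3[OF A] e_def abc[symmetric] pqr[symmetric] uvw[symmetric] sums
      by (simp add: algebra_simps power2_eq_square power3_eq_cube)
    then show ?thesis by (simp only: root)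
  qed
  have s_le: "a + b + c \<le> 6"
    using s by (auto simp: s_def)
  \<comment> \<open>Constant diagonal \<open>x\<close>; \<open>t\<close> stands for the sum of the
    off-diagonal products. Since \<open>y + z\<close> is at most 2, both candidates for
    \<open>t\<close> are at most 4.\<close>
  have no_const: False
    if x: "x = 4" and yz: "x + y + z \<le> 6" "0 \<le> y" "0 \<le> z" and t: "t = 7"
      and "t \<in> {3 * (y * z), y * y + y * z + z * z}" for x y z t :: real
  proof -
    have "(y + z) * (y + z) \<le> 2 * 2" using x yz by (intro mult_mono) auto
    then have "y * y + 2 * (y * z) + z * z \<le> 4" by (simp add: algebra_simps)
    moreover have "0 \<le> y * z" using yz by simp
    moreover have "2 * (y * z) \<le> y * y + z * z"
      using sum_squares_bound[of y z] by (simp add: power2_eq_square)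
    moreover have "t = 3 * (y * z) \<or> t = y * y + y * z + z * z" using that by simp
    ultimately show False using t by linarith
  qed
  \<comment> \<open>Here \<open>x\<close> occurs twice on the diagonal, \<open>y\<close> once, and
    \<open>z\<close> is the remaining entry of the first row.\<close>
  have no_double: False
    if "2 * x + y = 12" "x + y + z \<le> 6" "0 \<le> y" "0 \<le> z"
      "41 \<le> x * x + 2 * x * y" for x y z :: real
  proof -
    have "x = 6" "y = 0" using that by linarith+
    with that show False by simp
  qed
  have qw: "q \<in> {a, b, c}" "w \<in> {a, b, c}"
    using rows by auto
  \<comment> \<open>Dropping these products from \<open>e\<close> bounds the diagonal products from
    below.\<close>
  have "0 \<le> b * p + c * u + r * v"
    using rows nonneg by auto
  then have minors: "41 \<le> a * q + a * w + q * w"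
    using e by (simp add: e_def)
  have "q = a \<and> w = a"
  proof (rule ccontr)
    assume "\<not> (q = a \<and> w = a)"
    then consider "q = a" "w = b" | "q = b" "w = a" | "q = a" "w = c" | "q = c" "w = a"
      | "q = b" "w = b" | "q = c" "w = c" | "a + q + w = a + b + c"
      using qw by fastforce
    then show False
    proof cases
      case 1
      then show ?thesis
        using no_double[of a b c] tr s_le minors nonneg by (simp add: algebra_simps)
    next
      case 2
      then show ?thesis
        using no_double[of a b c] tr s_le minors nonneg by (simp add: algebra_simps)
    next
      case 3
      then show ?thesis
        using no_double[of a c b] tr s_le minors nonneg by (simp add: algebra_simps)
    next
      case 4
      then show ?thesis
        using no_double[of a c b] tr s_le minors nonneg by (simp add: algebra_simps)
    next
      case 5
      then show ?thesis
        using no_double[of b a c] tr s_le minors nonneg by (simp add: algebra_simps)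
    next
      case 6
      then show ?thesis
        using no_double[of c a b] tr s_le minors nonneg by (simp add: algebra_simps)
    next
      case 7
      then show ?thesis using tr s_le by simp
    qed
  qed
  then have diag: "q = a" "w = a" by auto
  \<comment> \<open>This holds even if some of \<open>a\<close>, \<open>b\<close>, \<open>c\<close>
    coincide.\<close>
  then have off_diag: "(p, r) \<in> {(b, c), (c, b)}" "(u, v) \<in> {(b, c), (c, b)}"
    using rows by auto
  have "a = 4" using tr diag by simp
  \<comment> \<open>The 7 is \<open>3 * 4 * 4 - 41\<close>.\<close>
  moreover have "b * p + c * u + r * v = 7"
    using e \<open>a = 4\<close> by (simp add: e_def diag)
  \<comment> \<open>The value \<open>3 * (b * c)\<close> comes from the circulant with rows
    \<open>(a,b,c)\<close>, \<open>(c,a,b)\<close>, \<open>(b,c,a)\<close>; the other three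
    arrangements give the second form.\<close>
  moreover have "b * p + c * u + r * v \<in> {3 * (b * c), b * b + b * c + c * c}"
    using off_diag by auto
  ultimately show False
    using no_const[of a b c "b * p + c * u + r * v"] s_le nonneg by simp
qed

end
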